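(* Let $d\in\mathbb{N}$. Suppose that $\Lambda_j\subset\mathbb{C}$, $j=1,\ldots,d$, are complete sets of conjugate algebraic integers, and define $\Lambda:=\Lambda_1\times\cdots\times\Lambda_d\subset\mathbb{C}^d$. If $\Lambda\subset E$ for a compact set $E\subset\mathbb{C}^d$ with $t_{\mathbb{Z}}(E)<1$, then the integer Chebyshev polynomials $C_n$ for $E$ satisfy $C_n(z)=0$ for all $z\in\Lambda$, for all sufficiently large $n\in\mathbb{N}$.
   Context: $\mathcal{P}_n^d(\mathbb{Z})$ is the set of polynomials $\sum_{|k|\le n}a_kz^k$ in $d$ complex variables of (total) degree at most $n$ with integer coefficients, where $k\in\mathbb{N}_0^d$, $|k|=\sum_i k_i$, $z^k=z_1^{k_1}\cdots z_d^{k_d}$. For compact $E\subset\mathbb{C}^d$, $\|f\|_E:=\sup_{z\in E}|f(z)|$. An integer Chebyshev polynomial of degree $n$ for $E$ is any $C_n\in\mathcal{P}_n^d(\mathbb{Z})$, $C_n\not\equiv0$, with $\|C_n\|_E=t_{\mathbb{Z}}(n,E):=\inf\{\|P\|_E:P\in\mathcal{P}_n^d(\mathbb{Z}),\ P\not\equiv0\}$. The integer Chebyshev constant is $t_{\mathbb{Z}}(E):=\lim_{n\to\infty}t_{\mathbb{Z}}(n,E)^{1/n}$. A complete set of conjugate algebraic integers is the set of all complex roots of the minimal polynomial over $\mathbb{Q}$ of some algebraic integer. *)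

theory Defs
  imports
    "HOL-Analysis.Analysis"
    "HOL-Library.Poly_Mapping"
    "HOL-Computational_Algebra.Polynomial"
begin

(* A polynomial in the variables z $ i (i :: 'd) with integer coefficients is the finitely
   supported family of its coefficients, indexed by the multi-indices k :: nat ^ 'd.  The
   number of variables is CARD('d). *)
type_synonym 'd int_mpoly = "(nat ^ 'd) \<Rightarrow>\<^sub>0 int"

definition poly_eval :: "('d::finite) int_mpoly \<Rightarrow> complex ^ 'd \<Rightarrow> complex" where
  "poly_eval P z = (\<Sum>k\<in>Poly_Mapping.keys P.
     of_int (Poly_Mapping.lookup P k) * (\<Prod>i\<in>UNIV. (z $ i) ^ (k $ i)))"

definition int_polys :: "nat \<Rightarrow> ('d::finite) int_mpoly set" where
  "int_polys n = {P. \<forall>k\<in>Poly_Mapping.keys P. (\<Sum>i\<in>UNIV. k $ i) \<le> n}"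

(* A real supremum: meaningful for nonempty E on which f is bounded, e.g. E compact and nonempty
   and f a polynomial. *)
definition sup_norm :: "(complex ^ 'd::finite) set \<Rightarrow> (complex ^ 'd \<Rightarrow> complex) \<Rightarrow> real" where
  "sup_norm E f = (SUP z\<in>E. norm (f z))"

definition cheb_inf :: "nat \<Rightarrow> (complex ^ 'd::finite) set \<Rightarrow> real" where
  "cheb_inf n E = (INF P \<in> int_polys n - {0}. sup_norm E (poly_eval P))"

definition int_chebyshev_poly ::
    "nat \<Rightarrow> (complex ^ 'd::finite) set \<Rightarrow> 'd int_mpoly \<Rightarrow> bool" where
  "int_chebyshev_poly n E C \<longleftrightarrow>
     C \<in> int_polys n \<and> C \<noteq> 0 \<and> sup_norm E (poly_eval C) = cheb_inf n E"

definition int_chebyshev_const :: "(complex ^ 'd::finite) set \<Rightarrow> real" where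
  "int_chebyshev_const E = lim (\<lambda>n. root n (cheb_inf n E))"

(* The monic polynomial over the rationals of least degree having the root alpha. *)
definition is_min_poly_rat :: "rat poly \<Rightarrow> complex \<Rightarrow> bool" where
  "is_min_poly_rat p \<alpha> \<longleftrightarrow>
     lead_coeff p = 1 \<and> poly (map_poly of_rat p) \<alpha> = 0 \<and>
     (\<forall>q. q \<noteq> 0 \<longrightarrow> poly (map_poly of_rat q) \<alpha> = 0 \<longrightarrow> degree p \<le> degree q)"

definition complete_conjugate_set :: "complex set \<Rightarrow> bool" where
  "complete_conjugate_set L \<longleftrightarrow>
     (\<exists>\<alpha> p. algebraic_int \<alpha> \<and> is_min_poly_rat p \<alpha> \<and>
            L = {z. poly (map_poly of_rat p) z = 0})"

end

theory Submission
  imports Defs "HOL-Computational_Algebra.Fundamental_Theorem_Algebra"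
begin

text \<open>
  The values of an integer polynomial \<open>C\<close> at the points of the product
  \<open>\<Lambda>\<close> of the conjugate sets behave like a set of conjugate algebraic integers: for
  every \<open>k\<close> the power sum \<open>\<Sum>\<^sub>w C(w)\<^sup>k\<close> over \<open>\<Lambda>\<close>, taken with multiplicities, is an
  integer. Indeed \<open>C\<^sup>k\<close> is an integer combination of monomials, and the sum of a monomial over
  a product set is a product of one-variable power sums of conjugate algebraic integers
  (\<open>sum_poly_eval_grid_Ints\<close>). If \<open>\<bar>C\<bar> < 1\<close> on \<open>\<Lambda>\<close>, these integers tend to zero
  as \<open>k\<close> grows, hence vanish from some \<open>k\<close> on, and a finite family of numbers
  whose high power sums all vanish consists of zeros (\<open>all_zero_if_power_sums_Ints\<close>).
  So an integer polynomial of norm less than 1 on \<open>E\<close> vanishes at every point of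
  \<open>\<Lambda>\<close>. A single product \<open>\<Prod>\<^sub>w C(w)\<close> would only yield one zero, because the Galois
  group need not act transitively on \<open>\<Lambda>\<close>; the power sums treat all points at once.

  Chebyshev polynomials of large degree do have norm less than 1: the minimal norm is at
  most 1 in every degree, because of the constant polynomial 1, and does not increase with the
  degree. If it never fell below 1, its \<open>n\<close>-th roots would converge to 1, against the
  hypothesis on the Chebyshev constant (\<open>cheb_inf_less_1\<close>).

  The integrality of the one-variable power sums (\<open>power_sum_of_roots_Ints\<close>) requires the
  minimal polynomial over \<open>\<rat>\<close> of an algebraic integer to have integer coefficients,
  which is Gauss's lemma (\<open>monic_rat_factor_of_monic_int_poly\<close>).
\<close>

section \<open>Minimal polynomials of algebraic integers\<close>

lemma of_rat_sum_complex: "of_rat (sum f A) = (\<Sum>a\<in>A. of_rat (f a) :: complex)"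
  by (induction A rule: infinite_finite_induct) (auto simp: of_rat_add)

lemma map_poly_of_rat_mult:
  "map_poly of_rat (p * q) = map_poly of_rat p * (map_poly of_rat q :: complex poly)"
  by (rule poly_eqI) (simp add: coeff_map_poly coeff_mult of_rat_sum_complex of_rat_mult)

lemma map_poly_of_rat_add:
  "map_poly of_rat (p + q) = map_poly of_rat p + (map_poly of_rat q :: complex poly)"
  by (rule poly_eqI) (simp add: coeff_map_poly of_rat_add)

lemma map_poly_of_int_mult:
  "map_poly of_int (p * q) = map_poly of_int p * (map_poly of_int q :: rat poly)"
  by (rule poly_eqI) (simp add: coeff_map_poly coeff_mult)

lemma clear_denominators:
  fixes p :: "rat poly"
  shows "\<exists>d>0. \<exists>P. map_poly of_int P = smult (of_int d) p"
proof (induction p)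
  case 0
  have "(1 :: int) > 0" "map_poly of_int 0 = smult (of_int 1) (0 :: rat poly)" by simp_all
  then show ?case by blast
next
  case (pCons a p)
  then obtain d P where d: "d > 0" "map_poly of_int P = smult (of_int d) p" by blast
  obtain x y where a: "a = of_int x / of_int y" "y > 0"
    by (metis quotient_of_denom_pos quotient_of_div surj_pair)
  have "map_poly of_int (pCons (x * d) (smult y P)) = smult (of_int (d * y)) (pCons a p)"
    using a d by (simp add: map_poly_pCons map_poly_smult mult.commute)
  with d a show ?case by (metis mult_pos_pos)
qed

text \<open>
  Gauss's lemma. After denominators \<open>d\<close> and \<open>e\<close> are cleared in the two monic factors, their
  contents divide the leading coefficients \<open>d\<close> and \<open>e\<close>, while the product of the
  contents is \<open>d * e\<close>; so the content of the first factor is all of \<open>d\<close> and cancels it.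
\<close>

lemma monic_rat_factor_of_monic_int_poly:
  fixes p q :: "rat poly" and f :: "int poly"
  assumes f: "lead_coeff f = 1" and p: "lead_coeff p = 1" and pq: "p * q = map_poly of_int f"
  shows "\<exists>P :: int poly. p = map_poly of_int P"
proof -
  obtain d P where d: "d > 0" and P: "map_poly of_int P = smult (of_int d) p"
    using clear_denominators by blast
  obtain e Q where e: "e > 0" and Q: "map_poly of_int Q = smult (of_int e) q"
    using clear_denominators by blast
  have "lead_coeff (p * q) = 1"
    unfolding pq using f by (simp add: degree_map_poly coeff_map_poly)
  then have q: "lead_coeff q = 1"
    using p by (simp add: lead_coeff_mult)
  have "coeff (map_poly of_int P) (degree p) = (of_int d :: rat)"
    unfolding P using p by simp
  then have "coeff P (degree p) = d" by (simp add: coeff_map_poly)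
  then have cP: "content P dvd d" by (metis content_dvd_coeff)
  have "coeff (map_poly of_int Q) (degree q) = (of_int e :: rat)"
    unfolding Q using q by simp
  then have "coeff Q (degree q) = e" by (simp add: coeff_map_poly)
  then have cQ: "content Q dvd e" by (metis content_dvd_coeff)
  have "(map_poly of_int (P * Q) :: rat poly) = map_poly of_int (smult (d * e) f)"
    by (simp add: map_poly_of_int_mult P Q map_poly_smult mult.commute flip: pq)
  then have PQ: "P * Q = smult (d * e) f"
    by (simp add: poly_eq_iff coeff_map_poly flip: of_int_mult)
  have "content f dvd 1"
    using content_dvd_coeff[of f "degree f"] f by simp
  then have "content f = 1"
    by (metis is_unit_normalize normalize_content)
  then have "content P * content Q = d * e"
    using d e by (simp add: PQ flip: content_mult)
  moreover have "content P \<le> d" "content Q \<le> e"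
    using cP cQ d e by (auto intro: zdvd_imp_le)
  moreover have "content P \<ge> 0" "content Q \<ge> 0"
    by (metis abs_ge_zero normalize_content normalize_int_def)+
  \<comment> \<open>Two bounds whose product is attained must both be attained.\<close>
  ultimately have "content P = d"
    using d e by (smt (verit) mult_less_cancel_right mult_left_mono mult_strict_mono)
  then have "smult d (primitive_part P) = P"
    by (metis content_times_primitive_part)
  then have "smult (of_int d) p = smult (of_int d) (map_poly of_int (primitive_part P))"
    by (metis P map_poly_smult of_int_0 of_int_mult)
  then have "p = map_poly of_int (primitive_part P)"
    using d smult_cancel[of "of_int d :: rat"] by simp
  then show ?thesis by blast
qed

text \<open>
  By minimality the minimal polynomial divides, over \<open>\<rat>\<close>, any monic integer polynomial that
  has \<open>\<alpha>\<close> as a root.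
\<close>

lemma is_min_poly_rat_integral:
  assumes \<alpha>: "algebraic_int \<alpha>" and p: "is_min_poly_rat p \<alpha>"
  shows "\<exists>P :: int poly. p = map_poly of_int P"
proof -
  obtain f :: "int poly" where f: "poly (map_poly of_int f) \<alpha> = 0" "lead_coeff f = 1"
    using \<alpha> by (auto simp: algebraic_int_altdef_ipoly)
  define F where "F = (map_poly of_int f :: rat poly)"
  have "map_poly of_rat F = (map_poly of_int f :: complex poly)"
    unfolding F_def by (subst map_poly_map_poly) (auto simp: o_def)
  then have F: "poly (map_poly of_rat F) \<alpha> = 0" using f by simp
  have p': "lead_coeff p = 1" "poly (map_poly of_rat p) \<alpha> = 0"
    and min: "\<And>q. q \<noteq> 0 \<Longrightarrow> poly (map_poly of_rat q) \<alpha> = 0 \<Longrightarrow> degree p \<le> degree q"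
    using p by (auto simp: is_min_poly_rat_def)
  have "F = p * (F div p) + F mod p" by simp
  then have "poly (map_poly of_rat F) \<alpha> = poly (map_poly of_rat (F mod p)) \<alpha>"
    by (metis map_poly_of_rat_add map_poly_of_rat_mult poly_add poly_mult p'(2) mult_zero_left add_0)
  then have "poly (map_poly of_rat (F mod p)) \<alpha> = 0" using F by simp
  then have "F mod p = 0"
    using min[of "F mod p"] degree_mod_less[of p F] p'(1) by fastforce
  then have "p * (F div p) = map_poly of_int f" by (metis F_def add.right_neutral mult_div_mod_eq)
  then show ?thesis using monic_rat_factor_of_monic_int_poly f(2) p'(1) by blast
qed

section \<open>Integrality of power sums\<close>

text \<open>
  The recursive content of Newton's identities. Put
  \<open>p = \<Prod>\<^sub>i (X - r\<^sub>i)\<close> and \<open>R\<^sub>k = \<Sum>\<^sub>i r\<^sub>i\<^sup>k p / (X - r\<^sub>i)\<close>. The coefficient of \<open>R\<^sub>k\<close> just below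
  the degree of \<open>p\<close> is the power sum \<open>s\<^sub>k\<close>, since each quotient is monic. Moreover
  \<open>R\<^sub>0\<close> is the derivative of \<open>p\<close>, and \<open>r\<^sub>i p / (X - r\<^sub>i) = X p / (X - r\<^sub>i) - p\<close> gives
  \<open>R\<^sub>k\<^sub>+\<^sub>1 = X R\<^sub>k - s\<^sub>k p\<close>, so all \<open>R\<^sub>k\<close> have integer coefficients by induction.
\<close>

lemma power_sum_of_roots_Ints:
  fixes r :: "'i \<Rightarrow> 'a::idom"
  assumes fin: "finite I" and coeffs: "\<And>m. coeff (\<Prod>i\<in>I. [:- r i, 1:]) m \<in> \<int>"
  shows "(\<Sum>i\<in>I. r i ^ k) \<in> \<int>"
proof -
  define p where "p = (\<Prod>i\<in>I. [:- r i, 1:])"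
  define q where "q i = (\<Prod>j\<in>I-{i}. [:- r j, 1:])" for i
  define R where "R k = (\<Sum>i\<in>I. smult (r i ^ k) (q i))" for k
  have pq: "p = [:- r i, 1:] * q i" if "i \<in> I" for i
    unfolding p_def q_def using fin that by (rule prod.remove)
  have deg_q: "degree (q i) = card I - 1" if "i \<in> I" for i
    unfolding q_def using fin that by (subst degree_prod_sum_eq) auto
  moreover have "lead_coeff (q i) = 1" for i
    unfolding q_def by (simp add: lead_coeff_prod)
  ultimately have "coeff (q i) (card I - 1) = 1" if "i \<in> I" for i
    using that by metis
  then have top: "coeff (R k) (card I - 1) = (\<Sum>i\<in>I. r i ^ k)" for k
    unfolding R_def by (simp add: coeff_sum)
  have "\<forall>m. coeff (R k) m \<in> \<int>"
  proof (induction k)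
    case 0
    have "R 0 = pderiv p"
      unfolding R_def p_def q_def by (simp add: pderiv_prod pderiv_pCons)
    then show ?case
      using coeffs by (auto simp: coeff_pderiv p_def simp del: of_nat_Suc)
  next
    case (Suc k)
    have "smult (r i ^ Suc k) (q i) = pCons 0 (smult (r i ^ k) (q i)) - smult (r i ^ k) p"
      if "i \<in> I" for i
      by (simp add: pq[OF that] smult_diff_right mult.commute)
    then have "R (Suc k) = (\<Sum>i\<in>I. [:0, 1:] * smult (r i ^ k) (q i)) - smult (\<Sum>i\<in>I. r i ^ k) p"
      unfolding R_def by (simp add: sum_subtractf smult_sum)
    then have "R (Suc k) = [:0, 1:] * R k - smult (\<Sum>i\<in>I. r i ^ k) p"
      unfolding R_def by (simp add: sum_distrib_left)
    then have "R (Suc k) = pCons 0 (R k) - smult (coeff (R k) (card I - 1)) p"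
      by (simp only: top) simp
    with Suc coeffs show ?case
      by (auto simp: coeff_pCons p_def split: nat.split)
  qed
  with top show ?thesis by metis
qed

text \<open>
  Conjugates are enumerated as the linear factors of the minimal polynomial. Sums over this
  enumeration count roots with multiplicity, as power sums read off from coefficients do.
\<close>

lemma complete_conjugate_set_roots:
  assumes "complete_conjugate_set L"
  obtains r :: "nat \<Rightarrow> complex" and n
  where "L = r ` {..<n}" "L \<noteq> {}" "\<And>k. (\<Sum>i<n. r i ^ k) \<in> \<int>"
proof -
  from assms obtain \<alpha> p where \<alpha>: "algebraic_int \<alpha>" and p: "is_min_poly_rat p \<alpha>"
    and L: "L = {z. poly (map_poly of_rat p) z = 0}"
    unfolding complete_conjugate_set_def by blast
  define p' where "p' = (map_poly of_rat p :: complex poly)"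
  obtain r where "smult (lead_coeff p') (\<Prod>i<degree p'. [:- r i, 1:]) = p'"
    using complex_poly_decompose' by blast
  moreover have "lead_coeff p' = 1"
    using p by (simp add: p'_def is_min_poly_rat_def degree_map_poly coeff_map_poly)
  ultimately have r: "p' = (\<Prod>i<degree p'. [:- r i, 1:])" by simp
  obtain P :: "int poly" where P: "p = map_poly of_int P"
    using is_min_poly_rat_integral[OF \<alpha> p] by blast
  have "L = {z. poly p' z = 0}" using L by (simp add: p'_def)
  also have "\<dots> = r ` {..<degree p'}"
    by (subst r) (auto simp: poly_prod)
  finally have "L = r ` {..<degree p'}" .
  moreover have "\<alpha> \<in> L" using p L by (simp add: is_min_poly_rat_def)
  moreover have "coeff p' m \<in> \<int>" for m by (simp add: p'_def P coeff_map_poly)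
  then have "(\<Sum>i<degree p'. r i ^ k) \<in> \<int>" for k
    by (intro power_sum_of_roots_Ints) (auto simp flip: r)
  ultimately show ?thesis using that by blast
qed

section \<open>Finite families with small integral power sums\<close>

lemma Ints_norm_less_1_eq_0:
  fixes x :: complex
  assumes "x \<in> \<int>" "norm x < 1"
  shows "x = 0"
  using assms by (elim Ints_cases) (simp add: norm_of_int)

text \<open>
  Linear combinations of the vanishing power sums give \<open>\<Sum>\<^sub>i v\<^sub>i\<^sup>K g(v\<^sub>i) = 0\<close> for every
  polynomial \<open>g\<close>. If \<open>g\<close> has as its roots all other values taken by the family, but not a given
  nonzero value \<open>u\<close>, the sum equals \<open>u\<^sup>K g(u)\<close> times the number of indices with value \<open>u\<close>,
  which is not zero.
\<close>

lemma all_zero_if_power_sums_eventually_zero: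
  fixes v :: "'i \<Rightarrow> 'a::field_char_0"
  assumes fin: "finite I" and zero: "\<And>k. k \<ge> K \<Longrightarrow> (\<Sum>i\<in>I. v i ^ k) = 0" and i: "i \<in> I"
  shows "v i = 0"
proof (rule ccontr)
  assume nz: "v i \<noteq> 0"
  define g where "g = (\<Prod>u\<in>v ` I - {v i}. [:- u, 1:])"
  define J where "J = {j\<in>I. v j = v i}"
  have g0: "poly g (v j) = 0" if "j \<in> I - J" for j
    using that fin by (auto simp: g_def J_def poly_prod)
  have gi: "poly g (v i) \<noteq> 0"
    using fin by (auto simp: g_def poly_prod)
  have J: "J \<subseteq> I" "finite J" "card J > 0"
    using fin i by (auto simp: J_def card_gt_0_iff)
  have "(\<Sum>j\<in>I. v j ^ K * poly g (v j)) = (\<Sum>j\<in>J. v j ^ K * poly g (v j))"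
    using fin J g0 by (intro sum.mono_neutral_right) auto
  also have "\<dots> = of_nat (card J) * (v i ^ K * poly g (v i))"
    by (simp add: J_def)
  finally have "(\<Sum>j\<in>I. v j ^ K * poly g (v j)) \<noteq> 0"
    using J nz gi by (auto simp: card_gt_0_iff)
  moreover have "(\<Sum>j\<in>I. v j ^ K * poly g (v j)) =
      (\<Sum>j\<in>I. \<Sum>m\<le>degree g. coeff g m * v j ^ (K + m))"
    by (simp add: poly_altdef sum_distrib_left power_add mult_ac)
  moreover have "\<dots> = (\<Sum>m\<le>degree g. coeff g m * (\<Sum>j\<in>I. v j ^ (K + m)))"
    by (subst sum.swap) (simp add: sum_distrib_left)
  ultimately show False by (simp add: zero)
qed

lemma all_zero_if_power_sums_Ints:
  fixes v :: "'i \<Rightarrow> complex"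
  assumes fin: "finite I" and ints: "\<And>k. (\<Sum>i\<in>I. v i ^ k) \<in> \<int>"
    and small: "\<And>i. i \<in> I \<Longrightarrow> norm (v i) < 1" and i: "i \<in> I"
  shows "v i = 0"
proof -
  have "(\<lambda>k. \<Sum>i\<in>I. v i ^ k) \<longlonglongrightarrow> (\<Sum>i\<in>I. 0)"
    using small by (intro tendsto_sum LIMSEQ_power_zero)
  then have "(\<lambda>k. norm (\<Sum>i\<in>I. v i ^ k)) \<longlonglongrightarrow> 0"
    by (simp add: tendsto_norm_zero)
  then have "\<forall>\<^sub>F k in sequentially. norm (\<Sum>i\<in>I. v i ^ k) < 1"
    by (rule order_tendstoD) simp
  then obtain K where "\<And>k. k \<ge> K \<Longrightarrow> norm (\<Sum>i\<in>I. v i ^ k) < 1"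
    by (auto simp: eventually_sequentially)
  then have "(\<Sum>i\<in>I. v i ^ k) = 0" if "k \<ge> K" for k
    using that ints Ints_norm_less_1_eq_0 by blast
  then show ?thesis by (rule all_zero_if_power_sums_eventually_zero[OF fin _ i])
qed

section \<open>Evaluation of integer polynomials\<close>

lemma poly_eval_superset:
  assumes "finite K" "Poly_Mapping.keys P \<subseteq> K"
  shows "poly_eval P z = (\<Sum>k\<in>K. of_int (Poly_Mapping.lookup P k) * (\<Prod>i\<in>UNIV. (z $ i) ^ (k $ i)))"
  unfolding poly_eval_def using assms
  by (intro sum.mono_neutral_left) (auto simp: in_keys_iff)

lemma poly_eval_zero [simp]: "poly_eval 0 z = 0"
  by (simp add: poly_eval_def)

lemma poly_eval_single:
  "poly_eval (Poly_Mapping.single k c) z = of_int c * (\<Prod>i\<in>UNIV. (z $ i) ^ (k $ i))"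
  by (subst poly_eval_superset[of "{k}"]) (auto split: if_splits)

lemma poly_eval_one [simp]: "poly_eval 1 z = 1"
  using poly_eval_single[of 0 1 z] by simp

lemma poly_eval_add: "poly_eval (P + Q) z = poly_eval P z + poly_eval Q z"
proof -
  let ?K = "Poly_Mapping.keys P \<union> Poly_Mapping.keys Q"
  have "Poly_Mapping.keys (P + Q) \<subseteq> ?K" by (rule keys_add)
  then show ?thesis
    by (simp add: poly_eval_superset[of ?K] lookup_add sum.distrib algebra_simps)
qed

text \<open>
  Reduces the multiplicativity of evaluation to single terms, since evaluation is additive.
\<close>

lemma poly_mapping_add_induct [case_names zero add]:
  fixes P :: "'a \<Rightarrow>\<^sub>0 'b::monoid_add"
  assumes "Q 0" "\<And>k c P. Q P \<Longrightarrow> Q (Poly_Mapping.single k c + P)"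
  shows "Q P"
proof (induction P rule: update_induct)
  case const
  show ?case by (rule assms)
next
  case (update f a b)
  have "Poly_Mapping.update a b f = Poly_Mapping.single a b + f"
    using update(1) by (intro poly_mapping_eqI)
      (auto simp: lookup_update lookup_add lookup_single in_keys_iff when_def)
  with assms(2) update(3) show ?case by metis
qed

lemma poly_eval_single_mult:
  "poly_eval (Poly_Mapping.single k c * P) z = poly_eval (Poly_Mapping.single k c) z * poly_eval P z"
  by (induction P rule: poly_mapping_add_induct)
    (simp_all add: poly_eval_add distrib_left mult_single poly_eval_single power_add prod.distrib)

lemma poly_eval_mult: "poly_eval (P * Q) z = poly_eval P z * poly_eval Q z"
  by (induction P rule: poly_mapping_add_induct)
    (simp_all add: poly_eval_add distrib_right poly_eval_single_mult)

lemma poly_eval_power: "poly_eval (P ^ k) z = poly_eval P z ^ k"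
  by (induction k) (simp_all add: poly_eval_mult)

lemma continuous_on_poly_eval: "continuous_on S (poly_eval P)"
  unfolding poly_eval_def by (intro continuous_intros)

text \<open>
  A monomial is a product of functions of one variable each, so its sum over a product set
  factors into one-variable power sums.
\<close>

lemma sum_poly_eval_grid_Ints:
  fixes r :: "'d::finite \<Rightarrow> nat \<Rightarrow> complex" and P :: "'d int_mpoly"
  assumes "\<And>j k. (\<Sum>i<n j. r j i ^ k) \<in> \<int>"
  shows "(\<Sum>\<iota>\<in>(\<Pi>\<^sub>E j\<in>UNIV. {..<n j}). poly_eval P (\<chi> j. r j (\<iota> j))) \<in> \<int>"
proof -
  have "(\<Sum>\<iota>\<in>(\<Pi>\<^sub>E j\<in>UNIV. {..<n j}). poly_eval P (\<chi> j. r j (\<iota> j))) =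
      (\<Sum>k\<in>Poly_Mapping.keys P. of_int (Poly_Mapping.lookup P k) *
        (\<Sum>\<iota>\<in>(\<Pi>\<^sub>E j\<in>UNIV. {..<n j}). \<Prod>j\<in>UNIV. r j (\<iota> j) ^ (k $ j)))"
    unfolding poly_eval_def by (subst sum.swap) (simp add: sum_distrib_left)
  also have "\<dots> = (\<Sum>k\<in>Poly_Mapping.keys P. of_int (Poly_Mapping.lookup P k) *
        (\<Prod>j\<in>UNIV. \<Sum>i<n j. r j i ^ (k $ j)))"
    by (simp add: prod_sum_PiE)
  also have "\<dots> \<in> \<int>"
    by (intro Ints_sum Ints_mult Ints_prod Ints_of_int assms)
  finally show ?thesis .
qed

section \<open>Integer polynomials of small norm\<close>

lemma bdd_above_norm_poly_eval:
  assumes "compact E"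
  shows "bdd_above ((\<lambda>z. norm (poly_eval P z)) ` E)"
  using assms by (intro bounded_imp_bdd_above compact_imp_bounded compact_continuous_image
      continuous_on_norm continuous_on_poly_eval)

lemma norm_poly_eval_le_sup_norm:
  assumes "compact E" "z \<in> E"
  shows "norm (poly_eval P z) \<le> sup_norm E (poly_eval P)"
  unfolding sup_norm_def by (rule cSUP_upper[OF assms(2) bdd_above_norm_poly_eval[OF assms(1)]])

lemma sup_norm_nonneg:
  assumes "compact E" "E \<noteq> {}"
  shows "0 \<le> sup_norm E (poly_eval P)"
  using assms norm_poly_eval_le_sup_norm norm_ge_zero order_trans by (metis equals0I)

text \<open>
  The values of \<open>P\<close> on the grid of conjugates have integer power sums because the powers of
  \<open>P\<close> are integer polynomials as well.
\<close>

lemma poly_eval_eq_0_on_conjugates: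
  fixes L :: "'d::finite \<Rightarrow> complex set"
  assumes L: "\<And>j. complete_conjugate_set (L j)"
    and small: "\<And>z. (\<forall>j. z $ j \<in> L j) \<Longrightarrow> norm (poly_eval P z) < 1"
    and z: "\<forall>j. z $ j \<in> L j"
  shows "poly_eval P z = 0"
proof -
  have "\<exists>r (n::nat). L j = r ` {..<n} \<and> (\<forall>k. (\<Sum>i<n. r i ^ k) \<in> \<int>)" for j
    by (rule complete_conjugate_set_roots[OF L[of j]]) blast
  then obtain r and n :: "'d \<Rightarrow> nat"
    where r: "\<And>j. L j = r j ` {..<n j}" "\<And>j k. (\<Sum>i<n j. r j i ^ k) \<in> \<int>"
    by metis
  define I where "I = (\<Pi>\<^sub>E j\<in>UNIV. {..<n j})"
  define v where "v \<iota> = poly_eval P (\<chi> j. r j (\<iota> j))" for \<iota>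
  have "(\<Sum>\<iota>\<in>I. v \<iota> ^ k) \<in> \<int>" for k
    using sum_poly_eval_grid_Ints[OF r(2), of "P ^ k"] by (simp add: I_def v_def poly_eval_power)
  moreover have "norm (v \<iota>) < 1" if "\<iota> \<in> I" for \<iota>
    unfolding v_def using that by (intro small) (auto simp: r(1) I_def)
  moreover have "finite I" unfolding I_def by (intro finite_PiE) auto
  ultimately have v0: "v \<iota> = 0" if "\<iota> \<in> I" for \<iota>
    using all_zero_if_power_sums_Ints[of I v] that by blast
  have "\<forall>j. \<exists>i<n j. z $ j = r j i" using z r(1) by auto
  then obtain \<iota> where "\<And>j. \<iota> j < n j" "\<And>j. z $ j = r j (\<iota> j)" by metis
  then have "\<iota> \<in> I" "(\<chi> j. r j (\<iota> j)) = z" by (auto simp: I_def vec_eq_iff)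
  with v0 show ?thesis unfolding v_def by metis
qed

lemma bdd_below_sup_norm:
  assumes "compact E" "E \<noteq> {}"
  shows "bdd_below ((\<lambda>P. sup_norm E (poly_eval P)) ` S)"
  using sup_norm_nonneg[OF assms] by (intro bdd_belowI2)

lemma one_in_int_polys: "1 \<in> int_polys n - {0}"
  by (simp add: int_polys_def)

lemma cheb_inf_antimono:
  assumes "compact E" "E \<noteq> {}" "m \<le> n"
  shows "cheb_inf n E \<le> cheb_inf m E"
proof -
  have "int_polys m - {0} \<subseteq> int_polys n - {0}"
    using assms(3) by (fastforce simp: int_polys_def)
  moreover have "int_polys m - {0} \<noteq> {}"
    using one_in_int_polys by blast
  ultimately show ?thesis
    unfolding cheb_inf_def by (intro cINF_superset_mono bdd_below_sup_norm assms) auto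
qed

lemma cheb_inf_le_1:
  assumes "compact E" "E \<noteq> {}"
  shows "cheb_inf n E \<le> 1"
proof -
  have "cheb_inf n E \<le> sup_norm E (poly_eval 1)"
    unfolding cheb_inf_def by (rule cINF_lower[OF bdd_below_sup_norm[OF assms] one_in_int_polys])
  then show ?thesis using assms by (simp add: sup_norm_def)
qed

text \<open>
  The constant is defined by \<^const>\<open>lim\<close>, which says something only about convergent sequences.
  Convergence is available exactly where it is needed: if no infimum is below 1, then all
  of them equal 1 and the sequence of roots is eventually constant.
\<close>

lemma cheb_inf_less_1:
  assumes "compact E" "E \<noteq> {}" "int_chebyshev_const E < 1"
  obtains m where "cheb_inf m E < 1"
proof (rule ccontr)
  assume "\<not> thesis"
  then have "cheb_inf n E = 1" for n
    using that[of n] cheb_inf_le_1[OF assms(1,2), of n] by argo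
  then have "\<forall>\<^sub>F n in sequentially. root n (cheb_inf n E) = 1"
    by (intro eventually_sequentiallyI[of 1]) simp
  then have "(\<lambda>n. root n (cheb_inf n E)) \<longlonglongrightarrow> 1"
    by (rule tendsto_eventually)
  then have "int_chebyshev_const E = 1"
    unfolding int_chebyshev_const_def by (rule limI)
  with assms(3) show False by simp
qed

theorem theorem1p4:
  fixes L :: "'d::finite \<Rightarrow> complex set"
    and E :: "(complex ^ 'd) set"
  assumes "\<And>j. complete_conjugate_set (L j)"
    and "compact E"
    and "{z. \<forall>j. z $ j \<in> L j} \<subseteq> E"
    and "int_chebyshev_const E < 1"
  shows "\<exists>N. \<forall>n\<ge>N. \<forall>C. int_chebyshev_poly n E C \<longrightarrow>
           (\<forall>z. (\<forall>j. z $ j \<in> L j) \<longrightarrow> poly_eval C z = 0)"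
proof -
  have "\<forall>j. \<exists>x. x \<in> L j"
    by (metis complete_conjugate_set_roots[OF assms(1)] ex_in_conv)
  then obtain w where "\<And>j. w j \<in> L j" by metis
  then have "(\<chi> j. w j) \<in> E" using assms(3) by auto
  then have E: "E \<noteq> {}" by blast
  obtain m where m: "cheb_inf m E < 1"
    using cheb_inf_less_1[OF assms(2) E assms(4)] .
  have "poly_eval C z = 0"
    if "n \<ge> m" and C: "int_chebyshev_poly n E C" and z: "\<forall>j. z $ j \<in> L j" for n C z
  proof -
    have "sup_norm E (poly_eval C) < 1"
      using C m cheb_inf_antimono[OF assms(2) E \<open>n \<ge> m\<close>] by (simp add: int_chebyshev_poly_def)
    then have "norm (poly_eval C y) < 1" if "\<forall>j. y $ j \<in> L j" for y
      using norm_poly_eval_le_sup_norm[OF assms(2), of y C] assms(3) that by fastforce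
    then show ?thesis using poly_eval_eq_0_on_conjugates assms(1) z by blast
  qed
  then show ?thesis by blast
qed

end
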